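(* Let $G$ be a finite attributed undirected graph and let $k$ be such that the $k$-HON $G^{(k)}$ is connected and non-bipartite. Let $\mathrm{R}$ be a relation on $\mathcal{S}^{(k)}$, let $g:\mathcal{S}^{(k)}\to\mathbb{R}$ be a function (with finite values), let $S\in\mathcal{S}^{(k)}$, and let $\mathcal{I}_S\subseteq\mathcal{S}^{(k)}$ (the supernode) be a nonempty set of subgraphs related to $S$, i.e. $S'\mathrm{R}S$ for all $S'\in\mathcal{I}_S$. Let $q\ge 1$ and let $\mathcal{T}^r=(S^r_1,\dots,S^r_{T_r})$, $1\le r\le q$, be the sample paths of $q$ independent non-backtracking random walk tours on $G^{(k)}$ started at the supernode $\mathcal{I}_S$, so that $S^r_1\in\mathcal{I}_S$, $S^r_{T_r}\in\mathcal{I}_S$ and $S^r_j\notin\mathcal{I}_S$ for all $1<j<T_r$, where $T_r=|\mathcal{T}^r|$. Define $$\hat{\alpha}(q,\mathrm{R},S)=\frac{\sum_{S'\in\mathcal{I}_S}|N^{(k)}(S')\setminus\mathcal{I}_S|}{q}\sum_{r=1}^{q}\sum_{i=2}^{|\mathcal{T}^r|-1}\frac{g(S^r_i)\,\mathbf{1}_{\{S^r_i\mathrm{R}S\}}}{|N^{(k)}(S^r_i)|}+\sum_{S'\in\mathcal{I}_S}g(S')\,\mathbf{1}_{\{S'\mathrm{R}S\}} .$$ Then $\hat{\alpha}(q,\mathrm{R},S)$ is an unbiased estimator of $\alpha(\mathrm{R},S)$, i.e. $\mathbb{E}[\hat{\alpha}(q,\mathrm{R},S)]=\alpha(\mathrm{R},S)$,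 where $\alpha(\mathrm{R},S)=\sum_{S'\in\mathcal{S}^{(k)}}g(S')\,\mathbf{1}_{\{S'\mathrm{R}S\}}$.
   Context: $G=(V,E,\Phi)$ is a finite simple undirected graph with node labels $\Phi$. $\mathcal{S}^{(k)}$ is the set of all connected induced subgraphs of $G$ with exactly $k$ nodes. $\mathbf{1}_{\{S'\mathrm{R}S\}}$ equals $1$ if $S'$ and $S$ are in relation $\mathrm{R}$ and $0$ otherwise. The $k$-HON of $G$ is the simple undirected graph $G^{(k)}=(\mathcal{S}^{(k)},E^{(k)})$ in which $S,S'\in\mathcal{S}^{(k)}$ are adjacent iff $|V(S)\cap V(S')|=k-1$. $N^{(k)}(S)=\{S'\in\mathcal{S}^{(k)} : |V(S)\cap V(S')|=k-1\}$ is the neighborhood of $S$ in $G^{(k)}$. Non-backtracking random walk (nRW) on $G^{(k)}$: the second-order Markov chain on $\mathcal{S}^{(k)}$ that, having current state $S'$ and previous state $S''$ (with $S''\in N^{(k)}(S')$), moves to a neighbor $S\in N^{(k)}(S')$ with probability $\mathbf{T}(S\mid S',S'')$, where $\mathbf{T}(S\mid S',S'')=0$ if $S=S''$ and $|N^{(k)}(S')|>1$; $=1$ if $S=S''$ and $|N^{(k)}(S')|=1$; and $=\frac{1}{|N^{(k)}(S')|-1}$ for any other neighbor $S$ of $S'$. Non-backtracking random walk tour started at the supernode $\mathcal{I}_S$: the set $\mathcal{I}_S$ is viewed as a single collapsed node whose incident edges are the edges of $G^{(k)}$ between $\mathcal{I}_S$ and its complement. The first step $(S_1,S_2)$ is chosen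 uniformly among all pairs with $S_1\in\mathcal{I}_S$ and $S_2\in N^{(k)}(S_1)\setminus\mathcal{I}_S$; then the walk continues as an nRW on $G^{(k)}$ (with previous state $S_1$ and current state $S_2$) until the first time $T>1$ at which it is in $\mathcal{I}_S$ again. The tour is $\mathcal{T}=(S_1,\dots,S_T)$ and $|\mathcal{T}|=T$. If $\mathcal{I}_S=\mathcal{S}^{(k)}$ (no edge leaves the supernode), the first term of $\hat\alpha$ is read as $0$. *)

theory Defs
  imports "HOL-Probability.Probability" "Graph_Theory.Graph_Theory"
begin

text \<open>
  Simple undirected graphs are the symmetric loop-free pair digraphs of \<^locale>\<open>pair_graph\<close>:
  an undirected edge is a pair of opposite arcs.
\<close>

definition bipartite :: "'b pair_pre_digraph \<Rightarrow> bool" where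
  "bipartite H \<longleftrightarrow> (\<exists>A B. pverts H = A \<union> B \<and> A \<inter> B = {} \<and>
     (\<forall>(u, v) \<in> parcs H. (u \<in> A \<and> v \<in> B) \<or> (u \<in> B \<and> v \<in> A)))"

definition neighborhood :: "'b pair_pre_digraph \<Rightarrow> 'b \<Rightarrow> 'b set" where
  "neighborhood H v = {w. (v, w) \<in> parcs H}"


subsection \<open>Higher-order networks\<close>

text \<open>
  The name \<open>connected\<close> is qualified because of the topological notion of the same name.
  Connected graphs have at least one vertex, so the set below is empty for \<open>k = 0\<close>,
  and the subtraction \<open>k - 1\<close> in the adjacency relation is never truncated.
\<close>

definition conn_induced_subgraphs :: "nat \<Rightarrow> 'a pair_pre_digraph \<Rightarrow> 'a pair_pre_digraph set" where
  "conn_induced_subgraphs k G =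
     {S. induced_subgraph (with_proj S) (with_proj G) \<and>
         Digraph_Component.connected (with_proj S) \<and> card (pverts S) = k}"

definition hon :: "nat \<Rightarrow> 'a pair_pre_digraph \<Rightarrow> 'a pair_pre_digraph pair_pre_digraph" where
  "hon k G = \<lparr> pverts = conn_induced_subgraphs k G,
     parcs = {(S, S'). S \<in> conn_induced_subgraphs k G \<and> S' \<in> conn_induced_subgraphs k G \<and>
                       card (pverts S \<inter> pverts S') = k - 1} \<rparr>"

lemma neighborhood_hon:
  assumes "S \<in> conn_induced_subgraphs k G"
  shows "neighborhood (hon k G) S =
    {S' \<in> conn_induced_subgraphs k G. card (pverts S \<inter> pverts S') = k - 1}"
  using assms by (auto simp: neighborhood_def hon_def)

lemma conn_induced_subgraphs_0:
  assumes "pair_graph G"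
  shows "conn_induced_subgraphs 0 G = {}"
proof -
  interpret pair_graph G by fact
  show ?thesis
    using finite_subset[OF _ pair_finite_verts]
    by (auto simp: conn_induced_subgraphs_def induced_subgraph_def subgraph_def
        Digraph_Component.connected_def strongly_connected_def mk_symmetric_def)
qed

lemma finite_conn_induced_subgraphs:
  assumes "pair_graph G"
  shows "finite (conn_induced_subgraphs k G)"
proof -
  interpret pair_graph G by fact
  have "conn_induced_subgraphs k G \<subseteq>
      (\<lambda>(V, E). \<lparr>pverts = V, parcs = E\<rparr>) ` (Pow (pverts G) \<times> Pow (parcs G))"
  proof
    fix S assume "S \<in> conn_induced_subgraphs k G"
    then have "pverts S \<subseteq> pverts G" "parcs S \<subseteq> parcs G"
      by (auto simp: conn_induced_subgraphs_def induced_subgraph_def subgraph_def)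
    then show "S \<in> (\<lambda>(V, E). \<lparr>pverts = V, parcs = E\<rparr>) ` (Pow (pverts G) \<times> Pow (parcs G))"
      by (intro image_eqI[where x = "(pverts S, parcs S)"]) auto
  qed
  then show ?thesis
    by (rule finite_subset) (simp add: pair_finite_verts pair_finite_arcs)
qed

lemma pair_graph_hon:
  assumes "pair_graph G"
  shows "pair_graph (hon k G)"
proof -
  have fin: "finite (pverts (hon k G))"
    using finite_conn_induced_subgraphs[OF assms] by (simp add: hon_def)
  have sub: "parcs (hon k G) \<subseteq> pverts (hon k G) \<times> pverts (hon k G)"
    by (auto simp: hon_def)
  have k: "k \<noteq> 0" if e: "e \<in> parcs (hon k G)" for e
  proof
    assume "k = 0"
    then have "pverts (hon k G) = {}"
      using conn_induced_subgraphs_0[OF assms] by (simp add: hon_def)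
    with sub e show False by blast
  qed
  have "symmetric (with_proj (hon k G))"
    unfolding symmetric_def with_proj_simps by (intro symI) (simp add: hon_def Int_commute)
  moreover have "fst e \<noteq> snd e" if e: "e \<in> parcs (hon k G)" for e
  proof
    assume "fst e = snd e"
    moreover have "card (pverts (fst e)) = k"
      and "card (pverts (fst e) \<inter> pverts (snd e)) = k - 1"
      using e unfolding hon_def conn_induced_subgraphs_def by (simp_all add: case_prod_beta)
    ultimately have "k = k - 1" by (metis Int_absorb)
    with k[OF e] show False by linarith
  qed
  moreover have "finite (parcs (hon k G))"
    using fin by (intro finite_subset[OF sub]) simp
  moreover have "fst e \<in> pverts (hon k G)" "snd e \<in> pverts (hon k G)"
    if "e \<in> parcs (hon k G)" for e
    using sub that by (auto simp: mem_Times_iff)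
  ultimately show ?thesis
    using fin by unfold_locales
qed


subsection \<open>Non-backtracking random walk tours\<close>

text \<open>
  \<open>nrw_prob H v v' v''\<close> is the probability of moving to \<open>v\<close> from the current
  state \<open>v'\<close> with previous state \<open>v''\<close>.
\<close>

definition nrw_prob :: "'b pair_pre_digraph \<Rightarrow> 'b \<Rightarrow> 'b \<Rightarrow> 'b \<Rightarrow> real" where
  "nrw_prob H v v' v'' =
     (if v \<notin> neighborhood H v' then 0
      else if v = v'' then (if card (neighborhood H v') = 1 then 1 else 0)
      else 1 / (real (card (neighborhood H v')) - 1))"

definition exit_pairs :: "'b pair_pre_digraph \<Rightarrow> 'b set \<Rightarrow> ('b \<times> 'b) set" where
  "exit_pairs H I = {(u, v). u \<in> I \<and> v \<in> neighborhood H u - I}"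

text \<open>
  \<open>X 1, X 2, \<dots>\<close> is a random sequence of nodes that, up to its first return to the supernode
  \<open>I\<close> after time 1, is a non-backtracking random walk leaving \<open>I\<close> along a uniformly chosen exit
  pair. Nothing is required of the sequence after this return, nor is it assumed that the
  return happens. If there are no exit pairs, the last two conditions are void.
\<close>

definition nrw_from_supernode ::
    "'w measure \<Rightarrow> 'b pair_pre_digraph \<Rightarrow> 'b set \<Rightarrow> (nat \<Rightarrow> 'w \<Rightarrow> 'b) \<Rightarrow> bool" where
  "nrw_from_supernode M H I X \<longleftrightarrow>
     (\<forall>i\<ge>1. X i \<in> measurable M (count_space (pverts H))) \<and>
     (\<forall>(u, v) \<in> exit_pairs H I.
        \<P>(\<omega> in M. X 1 \<omega> = u \<and> X 2 \<omega> = v) = 1 / real (card (exit_pairs H I))) \<and>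
     (\<forall>n\<ge>2. \<forall>s. \<forall>v \<in> pverts H.
        (\<forall>i\<in>{2..n}. s i \<notin> I) \<longrightarrow>
        \<P>(\<omega> in M. \<forall>i\<in>{1..n}. X i \<omega> = s i) > 0 \<longrightarrow>
        \<P>(\<omega> in M. X (Suc n) \<omega> = v \<bar> \<forall>i\<in>{1..n}. X i \<omega> = s i)
          = nrw_prob H v (s n) (s (n - 1)))"

text \<open>
  Sequences of states are indexed from 1. For a sequence that never returns to \<open>I\<close>,
  \<open>return_time\<close> is an unspecified constant.
\<close>

definition return_time :: "'b set \<Rightarrow> (nat \<Rightarrow> 'b) \<Rightarrow> nat" where
  "return_time I x = (LEAST t. 1 < t \<and> x t \<in> I)"

definition tour :: "'b set \<Rightarrow> (nat \<Rightarrow> 'b) \<Rightarrow> 'b list" where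
  "tour I x = map x [1..<Suc (return_time I x)]"


subsection \<open>The estimated quantity and its estimator\<close>

definition alpha :: "'b pair_pre_digraph \<Rightarrow> ('b \<Rightarrow> 'b \<Rightarrow> bool) \<Rightarrow> ('b \<Rightarrow> real) \<Rightarrow> 'b \<Rightarrow> real" where
  "alpha H R g S = (\<Sum>S' \<in> pverts H. g S' * of_bool (R S' S))"

text \<open>
  \<open>\<tau> r\<close> is the \<open>r\<close>-th tour. List positions count from 0, so its \<open>i\<close>-th state is \<open>\<tau> r ! (i - 1)\<close>.
  If \<open>I\<close> consists of all nodes, the first summand is 0 because its first factor is.
\<close>

definition alpha_hat ::
    "'b pair_pre_digraph \<Rightarrow> ('b \<Rightarrow> 'b \<Rightarrow> bool) \<Rightarrow> ('b \<Rightarrow> real) \<Rightarrow> 'b \<Rightarrow> 'b set \<Rightarrow>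
      nat \<Rightarrow> (nat \<Rightarrow> 'b list) \<Rightarrow> real" where
  "alpha_hat H R g S I q \<tau> =
     real (\<Sum>S' \<in> I. card (neighborhood H S' - I)) / real q *
       (\<Sum>r = 1..q. \<Sum>i = 2..length (\<tau> r) - 1.
          g (\<tau> r ! (i - 1)) * of_bool (R (\<tau> r ! (i - 1)) S)
            / real (card (neighborhood H (\<tau> r ! (i - 1)))))
     + (\<Sum>S' \<in> I. g S' * of_bool (R S' S))"

end

theory Submission
  imports Defs
begin

text \<open>
  On arcs, the non-backtracking kernel is doubly stochastic, so the uniform flow is invariant
  under it. The expected number of traversals of an arc ending outside \<open>I\<close> during a tour is
  therefore \<open>1 / |E|\<close>, where \<open>E\<close> is the set of exit pairs: the defect between the uniform flow
  and the expected traversals up to time \<open>n\<close> decreases to an invariant flow that leaks nothing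
  into \<open>I\<close>. The nodes it visits are closed under taking neighbours (all but the previous node
  are possible successors, and the previous node is visited too), so by connectedness the
  flow vanishes. Hence a node \<open>v\<close> outside \<open>I\<close> is visited \<open>deg v / |E|\<close> times on average, which the
  weights of the estimator compensate; summability of the traversal probabilities also gives
  almost sure return, by Borel-Cantelli.
\<close>

subsection \<open>Invariant flows of the non-backtracking walk\<close>

locale supernode = pair_graph H for H :: "'b pair_pre_digraph" +
  fixes I :: "'b set"
  assumes conn: "Digraph_Component.connected (with_proj H)"
    and I_subset: "I \<subseteq> pverts H"
    and I_nonempty: "I \<noteq> {}"
begin

abbreviation V :: "'b set" where
  "V \<equiv> pverts H"

abbreviation N :: "'b \<Rightarrow> 'b set" where
  "N \<equiv> neighborhood H"

abbreviation P :: "'b \<Rightarrow> 'b \<Rightarrow> 'b \<Rightarrow> real" where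
  "P \<equiv> nrw_prob H"

section \<open>Neighbourhoods and exit pairs\<close>

lemma finite_I: "finite I"
  using I_subset pair_finite_verts finite_subset by blast

lemma N_subset: "N v \<subseteq> V"
  using in_arcsD2 by (auto simp: neighborhood_def)

lemma N_verts: "w \<in> N v \<Longrightarrow> v \<in> V" "w \<in> N v \<Longrightarrow> w \<in> V"
  using in_arcsD1 in_arcsD2 by (auto simp: neighborhood_def)

lemma finite_N: "finite (N v)"
  using N_subset pair_finite_verts finite_subset by blast

lemma N_sym: "w \<in> N v \<longleftrightarrow> v \<in> N w"
  using arcs_symmetric by (auto simp: neighborhood_def)

text \<open>Connectedness in the form of an induction along paths. It is defined through the
  symmetrisation of the digraph, which has the same reachability because the arcs of
  \<open>H\<close> are symmetric.\<close>

lemma neighbour_closed_eq_verts: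
  assumes "v \<in> W" "v \<in> V"
    and closed: "\<And>x y. x \<in> W \<Longrightarrow> y \<in> N x \<Longrightarrow> y \<in> W"
  shows "V \<subseteq> W"
proof
  fix w assume "w \<in> V"
  then have "v \<rightarrow>\<^sup>*\<^bsub>with_proj (mk_symmetric (with_proj H))\<^esub> w"
    using conn assms(2) unfolding connected_def strongly_connected_def by simp
  then have "v \<rightarrow>\<^sup>*\<^bsub>with_proj H\<^esub> w"
    using reachable_mk_symmetric_eq sym_arcs by simp
  then show "w \<in> W"
  proof (induction rule: reachable_induct)
    case base
    show ?case by (rule assms(1))
  next
    case (step x y)
    then show ?case using closed by (auto simp: neighborhood_def)
  qed
qed

text \<open>An isolated vertex would have to be the whole graph. This keeps the degrees by which the
  estimator divides nonzero.\<close>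

lemma N_nonempty:
  assumes "v \<in> V - I"
  shows "N v \<noteq> {}"
proof
  assume "N v = {}"
  then have "V \<subseteq> {v}"
    using assms by (intro neighbour_closed_eq_verts[of v]) auto
  then show False using assms I_subset I_nonempty by auto
qed

lemma exit_pairs_nonempty:
  assumes "V \<noteq> I"
  shows "exit_pairs H I \<noteq> {}"
proof
  assume "exit_pairs H I = {}"
  moreover obtain v where "v \<in> I" using I_nonempty by auto
  ultimately have "V \<subseteq> I"
    using I_subset by (intro neighbour_closed_eq_verts[of v]) (auto simp: exit_pairs_def)
  then show False using assms I_subset by auto
qed

lemma exit_pairs_Sigma: "exit_pairs H I = Sigma I (\<lambda>u. N u - I)"
  by (auto simp: exit_pairs_def)

lemma finite_exit_pairs: "finite (exit_pairs H I)"
  by (simp add: exit_pairs_Sigma finite_I finite_N)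

lemma card_exit_pairs: "card (exit_pairs H I) = (\<Sum>u\<in>I. card (N u - I))"
  by (simp add: exit_pairs_Sigma card_SigmaI finite_I finite_N)

section \<open>The non-backtracking kernel\<close>

lemma P_eq_0: "w \<notin> N v \<Longrightarrow> P w v u = 0"
  by (simp add: nrw_prob_def)

lemma P_nonneg: "P w v u \<ge> 0"
proof (cases "w \<in> N v")
  case True
  \<comment> \<open>Rules out degree 0, where the quotient in \<open>nrw_prob\<close> would be
    -1.\<close>
  then have "card (N v) \<noteq> 0" using finite_N by auto
  then show ?thesis by (simp add: nrw_prob_def)
qed (simp add: nrw_prob_def)

lemma P_pos:
  assumes "u \<in> N v" "w \<in> N v" "w \<noteq> u"
  shows "P w v u > 0"
proof -
  have "card {u, w} \<le> card (N v)"
    using assms by (intro card_mono finite_N) auto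
  then show ?thesis using assms by (simp add: nrw_prob_def)
qed

text \<open>For a fixed middle node \<open>v\<close> the kernel is symmetric in the previous and the
  next node, so this one computation yields both its row sums and its column sums.\<close>

lemma sum_kernel_eq_1:
  assumes "u \<in> N v"
    and f: "\<And>w. w \<in> N v \<Longrightarrow> w \<noteq> u \<Longrightarrow> f w = 1 / (real (card (N v)) - 1)"
    and fu: "f u = (if card (N v) = 1 then 1 else 0)"
  shows "(\<Sum>w\<in>N v. f w) = 1"
proof -
  have "(\<Sum>w\<in>N v. f w) = f u + (\<Sum>w\<in>N v - {u}. f w)"
    using assms(1) finite_N by (rule sum.remove[rotated])
  also have "(\<Sum>w\<in>N v - {u}. f w) = (\<Sum>w\<in>N v - {u}. 1 / (real (card (N v)) - 1))"
    by (intro sum.cong) (auto simp: f)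
  also have "\<dots> = real (card (N v) - 1) / (real (card (N v)) - 1)"
    using assms(1) by simp
  also have "f u + \<dots> = 1"
  proof -
    have "card (N v) \<noteq> 0" using assms(1) finite_N by auto
    then have "card (N v) = 1 \<or> card (N v) \<ge> 2" by linarith
    \<comment> \<open>In degree 1 the quotient is 0 / 0 = 0, and the forced backtracking step
      \<open>f u\<close> carries the whole mass.\<close>
    then show ?thesis by (auto simp: fu of_nat_diff)
  qed
  finally show ?thesis .
qed

lemma sum_P_next: "u \<in> N v \<Longrightarrow> (\<Sum>w\<in>N v. P w v u) = 1"
  by (rule sum_kernel_eq_1) (auto simp: nrw_prob_def)

lemma sum_P_prev: "w \<in> N v \<Longrightarrow> (\<Sum>u\<in>N v. P w v u) = 1"
  by (rule sum_kernel_eq_1) (auto simp: nrw_prob_def)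

text \<open>Since the column sums are 1, the flow with constant value \<open>c\<close> is
  invariant.\<close>

lemma sum_P_prev_verts: "w \<in> N v \<Longrightarrow> (\<Sum>u\<in>N v. c * P w v u) = c"
  by (simp add: sum_P_prev flip: sum_distrib_left)

section \<open>Invariant flows without inflow from the supernode\<close>

lemma invariant_flow_eq_0:
  fixes r :: "'b \<Rightarrow> 'b \<Rightarrow> real"
  assumes nonneg: "\<And>v w. w \<in> N v - I \<Longrightarrow> r v w \<ge> 0"
    and exit: "\<And>v w. v \<in> I \<Longrightarrow> w \<in> N v - I \<Longrightarrow> r v w = 0"
    and inv: "\<And>v w. v \<in> V - I \<Longrightarrow> w \<in> N v - I \<Longrightarrow> r v w = (\<Sum>u\<in>N v. r u v * P w v u)"
    and arc: "w \<in> N v - I"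
  shows "r v w = 0"
proof -
  have finVI: "finite (V - I)" using pair_finite_verts by simp
  have term_nonneg: "r u v * P w v u \<ge> 0" if "v \<in> V - I" "u \<in> N v" for u v w
    using that nonneg[of v u] N_sym P_nonneg by (intro mult_nonneg_nonneg) auto
  \<comment> \<open>Comparing the total flow with itself one step later shows that nothing leaks into \<open>I\<close>.\<close>
  have total: "(\<Sum>v\<in>V - I. \<Sum>w\<in>N v - I. r v w) = (\<Sum>v\<in>V - I. \<Sum>u\<in>N v. r u v)"
  proof -
    \<comment> \<open>Arcs with tail in \<open>I\<close> can be added since they carry no flow; the
      sum is then regrouped by heads instead of tails.\<close>
    have "(\<Sum>v\<in>V - I. \<Sum>w\<in>N v - I. r v w) = (\<Sum>v\<in>V. \<Sum>w\<in>N v - I. r v w)"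
      using pair_finite_verts by (intro sum.mono_neutral_left) (auto simp: exit intro!: sum.neutral)
    also have "\<dots> = (\<Sum>(v, w)\<in>Sigma V (\<lambda>v. N v - I). r v w)"
      using pair_finite_verts finite_N by (intro sum.Sigma) auto
    also have "\<dots> = (\<Sum>(w, v)\<in>Sigma (V - I) N. r v w)"
      using N_sym N_verts
      by (intro sum.reindex_bij_witness[of _ "\<lambda>(a, b). (b, a)" "\<lambda>(a, b). (b, a)"]) auto
    also have "\<dots> = (\<Sum>v\<in>V - I. \<Sum>u\<in>N v. r u v)"
      using finVI finite_N by (intro sum.Sigma[symmetric]) auto
    finally show ?thesis .
  qed
  \<comment> \<open>The row sums of the kernel are 1, so what arrives at \<open>v\<close> and does
    not continue outside \<open>I\<close> has leaked into \<open>I\<close>.\<close>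
  have split: "(\<Sum>w\<in>N v - I. r v w) = (\<Sum>u\<in>N v. r u v) - (\<Sum>u\<in>N v. \<Sum>w\<in>N v \<inter> I. r u v * P w v u)"
    if v: "v \<in> V - I" for v
  proof -
    have "(\<Sum>w\<in>N v - I. r v w) = (\<Sum>u\<in>N v. \<Sum>w\<in>N v - I. r u v * P w v u)"
      by (subst sum.swap) (intro sum.cong refl inv[OF v])
    also have "\<dots> = (\<Sum>u\<in>N v. r u v - (\<Sum>w\<in>N v \<inter> I. r u v * P w v u))"
    proof (intro sum.cong refl)
      fix u assume u: "u \<in> N v"
      have "r u v = (\<Sum>w\<in>N v. r u v * P w v u)"
        using sum_P_next[OF u] by (simp flip: sum_distrib_left)
      also have "\<dots> = (\<Sum>w\<in>N v - I. r u v * P w v u) + (\<Sum>w\<in>N v \<inter> I. r u v * P w v u)"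
        using sum.Int_Diff[OF finite_N, of "\<lambda>w. r u v * P w v u" v I] by simp
      finally show "(\<Sum>w\<in>N v - I. r u v * P w v u) = r u v - (\<Sum>w\<in>N v \<inter> I. r u v * P w v u)"
        by simp
    qed
    finally show ?thesis by (simp add: sum_subtractf)
  qed
  have no_leak: "(\<Sum>v\<in>V - I. \<Sum>u\<in>N v. \<Sum>w\<in>N v \<inter> I. r u v * P w v u) = 0"
    using total by (simp add: split sum_subtractf)
  have leak: "r u v * P w v u = 0" if "v \<in> V - I" "u \<in> N v" "w \<in> N v \<inter> I" for u v w
  proof -
    have "(\<Sum>u\<in>N v. \<Sum>w\<in>N v \<inter> I. r u v * P w v u) = 0"
      by (rule sum_nonneg_0[OF finVI _ no_leak that(1)]) (intro sum_nonneg term_nonneg)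
    from sum_nonneg_0[OF finite_N _ this that(2)]
    have "(\<Sum>w\<in>N v \<inter> I. r u v * P w v u) = 0"
      using term_nonneg[OF that(1)] by (auto intro: sum_nonneg)
    from sum_nonneg_0[OF _ _ this that(3)] show ?thesis
      using term_nonneg[OF that(1,2)] finite_N by auto
  qed
  \<comment> \<open>Heads of arcs with positive flow. \<open>W\<close> misses \<open>I\<close> by
    construction, yet it turns out to be closed under neighbours.\<close>
  define W where "W = {v. \<exists>u\<in>N v. v \<in> V - I \<and> r u v > 0}"
  \<comment> \<open>\<open>P_pos\<close> spreads the flow to all neighbours of \<open>v\<close>
    except the previous node \<open>u\<close>; this fact covers \<open>u\<close>. A positive arc is
    no exit arc, so by invariance another positive arc feeds it.\<close>
  have tail: "u \<in> W" if uv: "u \<in> N v" "v \<in> V - I" "r u v > 0" for u v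
  proof -
    have u: "u \<in> V - I" using uv exit[of u v] N_sym N_verts by fastforce
    have "\<exists>t\<in>N u. r t u \<noteq> 0"
    proof (rule ccontr)
      assume "\<not> ?thesis"
      then have "r u v = 0" using inv[OF u, of v] uv N_sym by (auto intro!: sum.neutral)
      with uv show False by simp
    qed
    then obtain t where "t \<in> N u" "r t u \<noteq> 0" by auto
    moreover have "r t u \<ge> 0" using nonneg[of u t] u \<open>t \<in> N u\<close> N_sym by auto
    ultimately have "r t u > 0" by simp
    then show ?thesis using u \<open>t \<in> N u\<close> by (auto simp: W_def)
  qed
  have closed: "x \<in> W" if vW: "v \<in> W" and x: "x \<in> N v" for v x
  proof -
    obtain u where u: "u \<in> N v" "v \<in> V - I" "r u v > 0" using vW by (auto simp: W_def)
    show ?thesis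
    proof (cases "x = u")
      case True
      then show ?thesis using tail u by simp
    next
      case False
      have pos: "r u v * P x v u > 0" using u P_pos[OF u(1) x False] by simp
      then have xI: "x \<notin> I" using leak[OF u(2,1), of x] x by auto
      then have "r v x = (\<Sum>u\<in>N v. r u v * P x v u)" using inv u x by auto
      moreover have "r u v * P x v u \<le> (\<Sum>u\<in>N v. r u v * P x v u)"
        using u term_nonneg finite_N by (intro member_le_sum) auto
      ultimately have "r v x > 0" using pos by simp
      then show ?thesis using x xI N_sym N_verts by (auto simp: W_def)
    qed
  qed
  have "W = {}"
  proof (rule ccontr)
    assume "W \<noteq> {}"
    then obtain v where v: "v \<in> W" by auto
    have "v \<in> V" using v by (simp add: W_def)
    then have "V \<subseteq> W" using neighbour_closed_eq_verts[OF v] closed by blast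
    moreover obtain a where "a \<in> I" using I_nonempty by auto
    ultimately have "a \<in> W" using I_subset by auto
    with \<open>a \<in> I\<close> show False by (simp add: W_def)
  qed
  moreover have "w \<in> V - I" "v \<in> N w" using arc N_sym N_verts by auto
  ultimately have "\<not> r v w > 0" by (auto simp: W_def)
  then show ?thesis using nonneg[OF arc] by simp
qed

text \<open>
  \<open>c\<close> minus the partial sums evolves by the same kernel, and its limit is an invariant flow.
\<close>

lemma flow_sums:
  fixes p :: "nat \<Rightarrow> 'b \<Rightarrow> 'b \<Rightarrow> real"
  assumes nonneg: "\<And>m v w. p m v w \<ge> 0"
    and init_exit: "\<And>v w. v \<in> I \<Longrightarrow> w \<in> N v - I \<Longrightarrow> p 0 v w = c"
    and init_other: "\<And>v w. v \<in> V - I \<Longrightarrow> w \<in> N v - I \<Longrightarrow> p 0 v w = 0"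
    and step_exit: "\<And>m v w. v \<in> I \<Longrightarrow> w \<in> N v - I \<Longrightarrow> p (Suc m) v w = 0"
    and step: "\<And>m v w. v \<in> V - I \<Longrightarrow> w \<in> N v - I \<Longrightarrow>
      p (Suc m) v w = (\<Sum>u\<in>N v. p m u v * P w v u)"
    and c: "c \<ge> 0"
    and arc: "w \<in> N v - I"
  shows "(\<lambda>m. p m v w) sums c"
proof -
  define r where "r = (\<lambda>m v w. c - (\<Sum>i<m. p i v w))"
  have r0: "r 0 v w = c" for v w by (simp add: r_def)
  \<comment> \<open>An exit arc uses up all of \<open>c\<close> at time 0 and is never traversed
    again.\<close>
  have r_exit: "r (Suc m) v w = 0" if "v \<in> I" "w \<in> N v - I" for m v w
    using that by (simp add: r_def init_exit step_exit sum.lessThan_Suc_shift del: sum.lessThan_Suc)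
  \<comment> \<open>Off the exit arcs the term at time 0 vanishes, so the kernel maps each partial
    sum to the next one; it reproduces \<open>c\<close> by \<open>sum_P_prev_verts\<close>.\<close>
  have r_step: "r (Suc m) v w = (\<Sum>u\<in>N v. r m u v * P w v u)" if "v \<in> V - I" "w \<in> N v - I" for m v w
  proof -
    have "(\<Sum>i<Suc m. p i v w) = (\<Sum>i<m. \<Sum>u\<in>N v. p i u v * P w v u)"
      using that by (simp add: sum.lessThan_Suc_shift init_other step del: sum.lessThan_Suc)
    also have "\<dots> = (\<Sum>u\<in>N v. (\<Sum>i<m. p i u v) * P w v u)"
      by (subst sum.swap) (simp add: sum_distrib_right)
    finally show ?thesis
      using that sum_P_prev_verts[of w v c]
      by (simp add: r_def left_diff_distrib sum_subtractf)
  qed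
  \<comment> \<open>This bounds the partial sums by \<open>c\<close>, hence gives
    summability.\<close>
  have r_nonneg: "r m v w \<ge> 0" if "w \<in> N v - I" for m v w
    using that
  proof (induction m arbitrary: v w)
    case 0
    show ?case by (simp add: r0 c)
  next
    case (Suc m)
    show ?case
    proof (cases "v \<in> I")
      case True
      then show ?thesis using Suc.prems r_exit by simp
    next
      case False
      then have "v \<in> V - I" using Suc.prems N_verts by auto
      moreover have "r m u v \<ge> 0" if "u \<in> N v" for u
        using Suc.IH[of v u] that False N_sym by auto
      ultimately show ?thesis
        using Suc.prems r_step P_nonneg by (auto intro!: sum_nonneg mult_nonneg_nonneg)
    qed
  qed
  have summable: "summable (\<lambda>m. p m v w)" if "w \<in> N v - I" for v w
    using r_nonneg[OF that] nonneg by (intro summableI_nonneg_bounded[of _ c]) (auto simp: r_def)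
  define l where "l = (\<lambda>v w. c - (\<Sum>m. p m v w))"
  have lim: "(\<lambda>m. r m v w) \<longlonglongrightarrow> l v w" if "w \<in> N v - I" for v w
    unfolding r_def l_def using summable_LIMSEQ[OF summable[OF that]] by (intro tendsto_intros)
  have "l v w = 0"
  proof (rule invariant_flow_eq_0[OF _ _ _ arc])
    show "l v w \<ge> 0" if "w \<in> N v - I" for v w
      using LIMSEQ_le_const[OF lim[OF that]] r_nonneg[OF that] by auto
    show "l v w = 0" if "v \<in> I" "w \<in> N v - I" for v w
      using LIMSEQ_Suc[OF lim[OF that(2)]] r_exit[OF that] by (simp add: LIMSEQ_const_iff)
    show "l v w = (\<Sum>u\<in>N v. l u v * P w v u)" if vw: "v \<in> V - I" "w \<in> N v - I" for v w
    proof (rule LIMSEQ_unique)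
      show "(\<lambda>m. r (Suc m) v w) \<longlonglongrightarrow> l v w"
        using LIMSEQ_Suc[OF lim[OF vw(2)]] .
      show "(\<lambda>m. r (Suc m) v w) \<longlonglongrightarrow> (\<Sum>u\<in>N v. l u v * P w v u)"
        unfolding r_step[OF vw] using vw N_sym by (intro tendsto_intros lim) auto
    qed
  qed
  then show ?thesis using summable[OF arc] by (simp add: l_def sums_iff)
qed

end


subsection \<open>Traversal probabilities before the return\<close>

text \<open>\<open>proper\<close> guarantees exit pairs, so that the law of the first step is
  determined; the case \<open>V = I\<close> is treated in \<open>alpha_hat_unbiased\<close>.\<close>

locale nrw_walk = supernode H I + prob_space M
  for H :: "'b pair_pre_digraph" and I and M :: "'w measure" +
  fixes X :: "nat \<Rightarrow> 'w \<Rightarrow> 'b"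
  assumes nrw: "nrw_from_supernode M H I X"
    and proper: "V \<noteq> I"
begin

lemma X_measurable: "i \<ge> 1 \<Longrightarrow> X i \<in> measurable M (count_space V)"
  using nrw by (simp add: nrw_from_supernode_def)

lemma X_eq_sets: "i \<ge> 1 \<Longrightarrow> {\<omega> \<in> space M. X i \<omega> = v} \<in> events"
proof -
  assume "i \<ge> 1"
  then have "X i -` ({v} \<inter> V) \<inter> space M \<in> events"
    using X_measurable by (intro measurable_sets) auto
  moreover have "X i -` ({v} \<inter> V) \<inter> space M = {\<omega> \<in> space M. X i \<omega> = v}"
    using measurable_space[OF X_measurable[OF \<open>i \<ge> 1\<close>]] by auto
  ultimately show ?thesis by simp
qed

lemma X_notin_sets: "i \<ge> 1 \<Longrightarrow> {\<omega> \<in> space M. X i \<omega> \<notin> I} \<in> events"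
proof -
  assume "i \<ge> 1"
  then have "X i -` (V - I) \<inter> space M \<in> events"
    using X_measurable by (intro measurable_sets) auto
  moreover have "X i -` (V - I) \<inter> space M = {\<omega> \<in> space M. X i \<omega> \<notin> I}"
    using measurable_space[OF X_measurable[OF \<open>i \<ge> 1\<close>]] by auto
  ultimately show ?thesis by simp
qed

text \<open>The tour has not ended by time \<open>n\<close>. Times start at 2 because the state at
  time 1 is the starting point in \<open>I\<close>.\<close>

definition out :: "nat \<Rightarrow> 'w set" where
  "out n = {\<omega> \<in> space M. \<forall>j\<in>{2..n}. X j \<omega> \<notin> I}"

lemma out_Suc: "n \<ge> 1 \<Longrightarrow> out (Suc n) = {\<omega> \<in> out n. X (Suc n) \<omega> \<notin> I}"
  by (auto simp: out_def le_Suc_eq)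

definition X_at :: "nat \<Rightarrow> 'b \<Rightarrow> 'w set" where
  "X_at i v = {\<omega> \<in> space M. X i \<omega> = v}"

lemma out_sets [measurable]: "out n \<in> events"
  unfolding out_def by (intro sets.sets_Collect_finite_All X_notin_sets) auto

lemma X_at_sets: "i \<ge> 1 \<Longrightarrow> X_at i v \<in> events"
  unfolding X_at_def by (rule X_eq_sets)

lemma X_at_cover: "i \<ge> 1 \<Longrightarrow> \<omega> \<in> space M \<Longrightarrow> \<exists>v\<in>V. \<omega> \<in> X_at i v"
  using measurable_space[OF X_measurable] by (auto simp: X_at_def)

lemma prob_split:
  assumes "i \<ge> 1" "A \<in> events"
  shows "prob A = (\<Sum>v\<in>V. prob (A \<inter> X_at i v))"
proof -
  have "A = (\<Union>v\<in>V. A \<inter> X_at i v)"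
    using X_at_cover[OF assms(1)] sets.sets_into_space[OF assms(2)] by auto
  then have "prob A = prob (\<Union>v\<in>V. A \<inter> X_at i v)" by simp
  also have "\<dots> = (\<Sum>v\<in>V. prob (A \<inter> X_at i v))"
    using assms pair_finite_verts X_at_sets
    by (intro finite_measure_finite_Union) (auto simp: disjoint_family_on_def X_at_def)
  finally show ?thesis .
qed

text \<open>The transition law is given only conditionally on whole histories of positive
  probability. The event fixing the last two states is a finite disjoint union of histories; all
  share the factor \<open>P w v u\<close>, and null ones contribute nothing.\<close>

lemma next_prob:
  assumes n: "n \<ge> 2" and v: "v \<notin> I" and w: "w \<in> V"
  shows "prob (out n \<inter> X_at (n - 1) u \<inter> X_at n v \<inter> X_at (Suc n) w) =
    P w v u * prob (out n \<inter> X_at (n - 1) u \<inter> X_at n v)"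
proof -
  define E where "E = (\<lambda>s. {\<omega> \<in> space M. \<forall>i\<in>{1..n}. X i \<omega> = s i})"
  \<comment> \<open>Extensional functions are finite in number here, and distinct ones differ at
    some time up to \<open>n\<close>, so their events are disjoint.\<close>
  define Hs where "Hs = {s \<in> PiE {1..n} (\<lambda>_. V). (\<forall>i\<in>{2..n}. s i \<notin> I) \<and> s (n - 1) = u \<and> s n = v}"
  have finite_Hs: "finite Hs"
    unfolding Hs_def using finite_PiE[of "{1..n}" "\<lambda>_. V"] pair_finite_verts by simp
  have E_sets: "E s \<in> events" for s
    unfolding E_def by (intro sets.sets_Collect_finite_All X_eq_sets) auto
  have disj: "disjoint_family_on E Hs"
  proof (unfold disjoint_family_on_def, intro ballI impI)
    fix s t assume st: "s \<in> Hs" "t \<in> Hs" "s \<noteq> t"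
    then obtain i where "i \<in> {1..n}" "s i \<noteq> t i"
      unfolding Hs_def by (metis (mono_tags, lifting) PiE_ext mem_Collect_eq)
    then show "E s \<inter> E t = {}" unfolding E_def by force
  qed
  have decomp: "out n \<inter> X_at (n - 1) u \<inter> X_at n v = (\<Union>s\<in>Hs. E s)"
  proof (intro equalityI subsetI)
    fix \<omega> assume \<omega>: "\<omega> \<in> out n \<inter> X_at (n - 1) u \<inter> X_at n v"
    then have "restrict (\<lambda>i. X i \<omega>) {1..n} \<in> Hs"
      using n measurable_space[OF X_measurable] by (auto simp: Hs_def out_def X_at_def)
    then show "\<omega> \<in> (\<Union>s\<in>Hs. E s)"
      using \<omega> by (intro UN_I) (auto simp: E_def out_def)
  next
    fix \<omega> assume "\<omega> \<in> (\<Union>s\<in>Hs. E s)"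
    then obtain s where s: "s \<in> Hs" "\<omega> \<in> E s" by auto
    then have "X i \<omega> = s i" if "i \<in> {1..n}" for i using that by (auto simp: E_def)
    then show "\<omega> \<in> out n \<inter> X_at (n - 1) u \<inter> X_at n v"
      using s n by (auto simp: Hs_def E_def out_def X_at_def)
  qed
  have one: "prob (E s \<inter> X_at (Suc n) w) = P w v u * prob (E s)" if s: "s \<in> Hs" for s
  proof (cases "prob (E s) = 0")
    case True
    then have "prob (E s \<inter> X_at (Suc n) w) \<le> 0"
      using E_sets finite_measure_mono[of "E s \<inter> X_at (Suc n) w" "E s"] by simp
    then show ?thesis using True by (simp add: measure_le_0_iff)
  next
    case False
    then have pos: "prob (E s) > 0" by (simp add: zero_less_measure_iff)
    then have "\<P>(\<omega> in M. X (Suc n) \<omega> = w \<bar> \<forall>i\<in>{1..n}. X i \<omega> = s i) = P w (s n) (s (n - 1))"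
      using nrw n w s unfolding nrw_from_supernode_def E_def Hs_def by blast
    then have "prob {\<omega> \<in> space M. X (Suc n) \<omega> = w \<and> (\<forall>i\<in>{1..n}. X i \<omega> = s i)} / prob (E s) = P w v u"
      using s by (simp add: cond_prob_def E_def Hs_def)
    moreover have "{\<omega> \<in> space M. X (Suc n) \<omega> = w \<and> (\<forall>i\<in>{1..n}. X i \<omega> = s i)} = E s \<inter> X_at (Suc n) w"
      by (auto simp: E_def X_at_def)
    ultimately show ?thesis using pos by (simp add: divide_eq_eq)
  qed
  have "prob (out n \<inter> X_at (n - 1) u \<inter> X_at n v \<inter> X_at (Suc n) w) = prob (\<Union>s\<in>Hs. E s \<inter> X_at (Suc n) w)"
    unfolding decomp by (simp add: Int_UN_distrib2)
  also have "\<dots> = (\<Sum>s\<in>Hs. prob (E s \<inter> X_at (Suc n) w))"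
    using finite_Hs E_sets X_at_sets disj
    by (intro finite_measure_finite_Union) (auto simp: disjoint_family_on_def, blast)
  also have "\<dots> = P w v u * (\<Sum>s\<in>Hs. prob (E s))"
    by (simp add: one sum_distrib_left)
  also have "(\<Sum>s\<in>Hs. prob (E s)) = prob (out n \<inter> X_at (n - 1) u \<inter> X_at n v)"
    unfolding decomp using finite_Hs E_sets disj
    by (intro finite_measure_finite_Union[symmetric]) auto
  finally show ?thesis .
qed

text \<open>The index 0 stands for the first step, from time 1 to time 2. For \<open>v\<close> in
  \<open>I\<close> the value is 0: the step that ends the tour is not counted.\<close>

definition traversal_prob :: "nat \<Rightarrow> 'b \<Rightarrow> 'b \<Rightarrow> real" where
  "traversal_prob m u v = prob (out (m + 2) \<inter> X_at (m + 1) u \<inter> X_at (m + 2) v)"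

lemma traversal_prob_nonneg: "traversal_prob m u v \<ge> 0"
  by (simp add: traversal_prob_def)

lemma card_exit_pos: "card (exit_pairs H I) > 0"
  using exit_pairs_nonempty[OF proper] finite_exit_pairs by (simp add: card_gt_0_iff)

lemma prob_first_step:
  "(u, v) \<in> exit_pairs H I \<Longrightarrow> prob (X_at 1 u \<inter> X_at 2 v) = 1 / real (card (exit_pairs H I))"
proof -
  have "X_at 1 u \<inter> X_at 2 v = {\<omega> \<in> space M. X 1 \<omega> = u \<and> X 2 \<omega> = v}"
    by (auto simp: X_at_def)
  then show "(u, v) \<in> exit_pairs H I \<Longrightarrow> ?thesis"
    using nrw by (auto simp: nrw_from_supernode_def)
qed

text \<open>The exit pairs already carry total probability 1, so a further disjoint event has no
  mass left.\<close>

lemma prob_first_step_eq_0: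
  assumes "(u, v) \<notin> exit_pairs H I"
  shows "prob (X_at 1 u \<inter> X_at 2 v) = 0"
proof -
  let ?A = "\<lambda>(u, v). X_at 1 u \<inter> X_at 2 v"
  have "prob (\<Union>e\<in>insert (u, v) (exit_pairs H I). ?A e) = (\<Sum>e\<in>insert (u, v) (exit_pairs H I). prob (?A e))"
    using finite_exit_pairs X_at_sets
    by (intro finite_measure_finite_Union) (auto simp: disjoint_family_on_def X_at_def)
  also have "\<dots> = prob (X_at 1 u \<inter> X_at 2 v) + (\<Sum>e\<in>exit_pairs H I. prob (?A e))"
    using assms finite_exit_pairs by simp
  also have "(\<Sum>e\<in>exit_pairs H I. prob (?A e)) = (\<Sum>e\<in>exit_pairs H I. 1 / real (card (exit_pairs H I)))"
    by (intro sum.cong refl) (simp add: split_beta prob_first_step del: One_nat_def)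
  also have "\<dots> = 1"
    using card_exit_pos by simp
  finally have "prob (X_at 1 u \<inter> X_at 2 v) \<le> 0"
    using prob_le_1[of "\<Union>e\<in>insert (u, v) (exit_pairs H I). ?A e"] by simp
  then show ?thesis by (simp add: measure_le_0_iff)
qed

lemma traversal_prob_0: "v \<notin> I \<Longrightarrow> traversal_prob 0 u v = (if (u, v) \<in> exit_pairs H I then 1 / real (card (exit_pairs H I)) else 0)"
proof -
  assume "v \<notin> I"
  then have "out 2 \<inter> X_at 1 u \<inter> X_at 2 v = X_at 1 u \<inter> X_at 2 v"
    by (auto simp: out_def X_at_def)
  then have "traversal_prob 0 u v = prob (X_at 1 u \<inter> X_at 2 v)"
    by (simp only: traversal_prob_def add_0)
  then show ?thesis
    using prob_first_step[of u v] prob_first_step_eq_0[of u v] by argo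
qed

lemma traversal_prob_Suc_exit: "v \<in> I \<Longrightarrow> traversal_prob (Suc m) v w = 0"
proof -
  assume "v \<in> I"
  then have "out (Suc m + 2) \<inter> X_at (Suc m + 1) v = {}"
    by (auto simp: out_def X_at_def)
  then show ?thesis by (simp add: traversal_prob_def del: add_Suc)
qed

text \<open>The forward equation for arcs: split by the state two steps before the arrival at
  \<open>w\<close> and apply \<open>next_prob\<close>.\<close>

lemma traversal_prob_Suc:
  assumes "v \<notin> I" "w \<in> V - I"
  shows "traversal_prob (Suc m) v w = (\<Sum>u\<in>V. traversal_prob m u v * P w v u)"
proof -
  define A where "A = out (m + 2) \<inter> X_at (m + 2) v \<inter> X_at (m + 3) w"
  have "out (Suc m + 2) \<inter> X_at (Suc m + 1) v \<inter> X_at (Suc m + 2) w = A"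
    using assms out_Suc[of "m + 2"] by (auto simp: A_def X_at_def numeral_3_eq_3)
  then have "traversal_prob (Suc m) v w = prob A" by (simp add: traversal_prob_def)
  also have "\<dots> = (\<Sum>u\<in>V. prob (A \<inter> X_at (m + 1) u))"
    by (intro prob_split) (auto simp: A_def intro!: sets.Int X_at_sets)
  also have "\<dots> = (\<Sum>u\<in>V. traversal_prob m u v * P w v u)"
  proof (intro sum.cong refl)
    fix u
    have "A \<inter> X_at (m + 1) u = out (m + 2) \<inter> X_at (m + 2 - 1) u \<inter> X_at (m + 2) v \<inter> X_at (Suc (m + 2)) w"
      by (auto simp: A_def numeral_3_eq_3)
    then have "prob (A \<inter> X_at (m + 1) u) = P w v u * prob (out (m + 2) \<inter> X_at (m + 2 - 1) u \<inter> X_at (m + 2) v)"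
      using next_prob[of "m + 2" v w u] assms by simp
    then show "prob (A \<inter> X_at (m + 1) u) = traversal_prob m u v * P w v u" by (simp add: traversal_prob_def)
  qed
  finally show ?thesis .
qed

text \<open>The first step almost surely follows an exit pair, and later the kernel vanishes off the
  arcs. This cuts the sum in \<open>traversal_prob_Suc\<close> down to \<open>N v\<close>.\<close>

lemma traversal_prob_eq_0:
  assumes "v \<in> V - I" "v \<notin> N u"
  shows "traversal_prob m u v = 0"
proof (cases m)
  case 0
  then show ?thesis using assms by (auto simp: traversal_prob_0 exit_pairs_def)
next
  case (Suc m')
  then show ?thesis
    using assms by (cases "u \<in> I") (auto simp: traversal_prob_Suc_exit traversal_prob_Suc P_eq_0)
qed

text \<open>An instance of \<open>flow_sums\<close>: the first step is uniform on the exit pairs,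
  and no later counted step starts in \<open>I\<close>.\<close>

lemma traversal_prob_sums:
  assumes "v \<in> N u - I"
  shows "(\<lambda>m. traversal_prob m u v) sums (1 / real (card (exit_pairs H I)))"
proof (rule flow_sums[OF _ _ _ _ _ _ assms])
  show "traversal_prob (Suc m) v w = (\<Sum>u\<in>N v. traversal_prob m u v * P w v u)" if "v \<in> V - I" "w \<in> N v - I" for m v w
  proof -
    have "traversal_prob (Suc m) v w = (\<Sum>u\<in>V. traversal_prob m u v * P w v u)"
      using that N_verts by (intro traversal_prob_Suc) auto
    also have "\<dots> = (\<Sum>u\<in>N v. traversal_prob m u v * P w v u)"
      using N_subset pair_finite_verts that N_sym by (intro sum.mono_neutral_right) (auto simp: traversal_prob_eq_0)
    finally show ?thesis .
  qed
qed (auto simp: traversal_prob_0 traversal_prob_Suc_exit exit_pairs_def traversal_prob_nonneg)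

text \<open>Transfers summability from the traversal probabilities to the probabilities of not
  having returned.\<close>

lemma prob_out_eq:
  "prob (out (m + 2)) = (\<Sum>u\<in>V. \<Sum>v\<in>V - I. traversal_prob m u v)"
proof -
  have "prob (out (m + 2)) = (\<Sum>u\<in>V. prob (out (m + 2) \<inter> X_at (m + 1) u))"
    by (intro prob_split) auto
  also have "\<dots> = (\<Sum>u\<in>V. \<Sum>v\<in>V. traversal_prob m u v)"
    unfolding traversal_prob_def by (intro sum.cong refl prob_split sets.Int X_at_sets) auto
  also have "\<dots> = (\<Sum>u\<in>V. \<Sum>v\<in>V - I. traversal_prob m u v)"
  proof (rule sum.cong[OF refl])
    fix u
    have "out (m + 2) \<inter> X_at (m + 2) v = {}" if "v \<in> I" for v
      using that by (auto simp: out_def X_at_def)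
    then have "\<forall>v\<in>V - (V - I). traversal_prob m u v = 0"
      by (auto simp: traversal_prob_def Int_ac)
    then show "(\<Sum>v\<in>V. traversal_prob m u v) = (\<Sum>v\<in>V - I. traversal_prob m u v)"
      using pair_finite_verts by (intro sum.mono_neutral_right) auto
  qed
  finally show ?thesis .
qed

end


subsection \<open>Sums along a tour\<close>

text \<open>The inner sum of \<open>alpha_hat\<close> with a general weight. The endpoints of a tour
  are left out, and list position \<open>i - 1\<close> is time \<open>i\<close>.\<close>

definition tour_sum :: "('b \<Rightarrow> real) \<Rightarrow> 'b list \<Rightarrow> real" where
  "tour_sum f \<tau> = (\<Sum>i = 2..length \<tau> - 1. f (\<tau> ! (i - 1)))"

text \<open>Trades the random upper limit for a series whose terms vanish from the return on, so
  that expectations can be taken term by term. The assumptions provide a return, which makes the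
  \<open>LEAST\<close> in \<open>return_time\<close> meaningful.\<close>

lemma tour_sum_eq_suminf:
  assumes "t > 1" "x t \<in> I"
  shows "tour_sum f (tour I x) = (\<Sum>m. if \<forall>j\<in>{2..m + 2}. x j \<notin> I then f (x (m + 2)) else 0)"
proof -
  define T where "T = return_time I x"
  have T: "1 < T" "x T \<in> I"
    using LeastI[of "\<lambda>t. 1 < t \<and> x t \<in> I" t] assms by (auto simp: T_def return_time_def)
  have before: "x j \<notin> I" if "1 < j" "j < T" for j
    using not_less_Least[of j "\<lambda>t. 1 < t \<and> x t \<in> I"] that by (auto simp: T_def return_time_def)
  \<comment> \<open>The term of index \<open>m\<close> belongs to time \<open>m + 2\<close>; for
    \<open>T = 2\<close> the tour has no interior states.\<close>
  have avoid: "(\<forall>j\<in>{2..m + 2}. x j \<notin> I) \<longleftrightarrow> m < T - 2" for m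
    using T before by (fastforce simp: not_less)
  have "tour_sum f (tour I x) = (\<Sum>i = 2..T - 1. f (x i))"
    unfolding tour_sum_def tour_def T_def[symmetric] using T
    by (intro sum.cong) (auto simp: nth_append nth_map_upt simp del: upt_Suc)
  also have "\<dots> = (\<Sum>m<T - 2. f (x (m + 2)))"
    using T by (intro sum.reindex_bij_witness[of _ "\<lambda>m. m + 2" "\<lambda>i. i - 2"])
      (auto simp del: add_2_eq_Suc')
  also have "\<dots> = (\<Sum>m<T - 2. if \<forall>j\<in>{2..m + 2}. x j \<notin> I then f (x (m + 2)) else 0)"
    by (intro sum.cong refl) (simp only: avoid if_True lessThan_iff)
  also have "\<dots> = (\<Sum>m. if \<forall>j\<in>{2..m + 2}. x j \<notin> I then f (x (m + 2)) else 0)"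
    by (intro suminf_finite[symmetric]) (auto simp only: avoid lessThan_iff finite_lessThan if_False)
  finally show ?thesis .
qed

section \<open>Expectation of the sum along one tour\<close>

context nrw_walk
begin

definition visit_term :: "('b \<Rightarrow> real) \<Rightarrow> nat \<Rightarrow> 'w \<Rightarrow> real" where
  "visit_term f m \<omega> = (if \<omega> \<in> out (m + 2) then f (X (m + 2) \<omega>) else 0)"

text \<open>The previous state \<open>u\<close> is summed over because the known probabilities are
  those of arcs.\<close>

lemma visit_term_expand:
  assumes "\<omega> \<in> space M"
  shows "visit_term f m \<omega> = (\<Sum>u\<in>V. \<Sum>v\<in>V - I.
    f v * indicator (out (m + 2) \<inter> X_at (m + 1) u \<inter> X_at (m + 2) v) \<omega>)"
proof (cases "\<omega> \<in> out (m + 2)")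
  case True
  define u0 v0 where "u0 = X (m + 1) \<omega>" and "v0 = X (m + 2) \<omega>"
  have u0: "u0 \<in> V" and v0: "v0 \<in> V - I"
    using measurable_space[OF X_measurable assms] True by (auto simp: u0_def v0_def out_def)
  have "(\<Sum>u\<in>V. \<Sum>v\<in>V - I. f v * indicator (out (m + 2) \<inter> X_at (m + 1) u \<inter> X_at (m + 2) v) \<omega>) =
    (\<Sum>u\<in>V. if u = u0 then (\<Sum>v\<in>V - I. if v = v0 then f v else 0) else 0)"
    using True assms
    by (intro sum.cong refl) (auto simp: X_at_def u0_def v0_def indicator_def intro!: sum.cong sum.neutral)
  also have "\<dots> = f v0"
    using u0 v0 pair_finite_verts by (simp only: sum.delta finite_Diff if_True)
  also have "\<dots> = visit_term f m \<omega>"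
    using True by (simp add: visit_term_def v0_def)
  finally show ?thesis by (rule sym)
next
  case False
  then show ?thesis by (simp add: visit_term_def)
qed

lemma visit_term_integral: "has_bochner_integral M (visit_term f m) (\<Sum>u\<in>V. \<Sum>v\<in>V - I. f v * traversal_prob m u v)"
proof -
  have "has_bochner_integral M (\<lambda>\<omega>. \<Sum>u\<in>V. \<Sum>v\<in>V - I.
      f v * indicator (out (m + 2) \<inter> X_at (m + 1) u \<inter> X_at (m + 2) v) \<omega>)
    (\<Sum>u\<in>V. \<Sum>v\<in>V - I. f v * traversal_prob m u v)"
    unfolding traversal_prob_def
    by (intro has_bochner_integral_sum has_bochner_integral_mult_right has_bochner_integral_real_indicator)
      (auto intro!: sets.Int X_at_sets simp: less_top[symmetric])
  then show ?thesis
    by (subst has_bochner_integral_cong[OF refl visit_term_expand refl]) auto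
qed

lemma visit_term_norm: "norm (visit_term f m \<omega>) = visit_term (\<lambda>v. \<bar>f v\<bar>) m \<omega>"
  by (simp add: visit_term_def)

text \<open>Each of the \<open>card (N v)\<close> arcs into \<open>v\<close> contributes the same
  expected number of traversals, by \<open>traversal_prob_sums\<close>.\<close>

lemma visit_term_integral_sums:
  "(\<lambda>m. \<Sum>u\<in>V. \<Sum>v\<in>V - I. f v * traversal_prob m u v) sums
    ((\<Sum>v\<in>V - I. f v * real (card (N v))) / real (card (exit_pairs H I)))"
proof -
  let ?c = "real (card (exit_pairs H I))"
  have "(\<lambda>m. \<Sum>u\<in>V. \<Sum>v\<in>V - I. f v * traversal_prob m u v) sums
    (\<Sum>u\<in>V. \<Sum>v\<in>V - I. f v * (if u \<in> N v then 1 / ?c else 0))"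
  proof (intro sums_sum sums_mult)
    fix u v assume v: "v \<in> V - I"
    show "(\<lambda>m. traversal_prob m u v) sums (if u \<in> N v then 1 / ?c else 0)"
      using v N_sym traversal_prob_sums[of v u] traversal_prob_eq_0[of v u] by (cases "u \<in> N v") auto
  qed
  also have "(\<Sum>u\<in>V. \<Sum>v\<in>V - I. f v * (if u \<in> N v then 1 / ?c else 0)) =
    (\<Sum>v\<in>V - I. \<Sum>u\<in>V. if u \<in> N v then f v / ?c else 0)"
    by (subst sum.swap) (intro sum.cong refl, simp)
  also have "\<dots> = (\<Sum>v\<in>V - I. f v * real (card (N v))) / ?c"
  proof -
    have "(\<Sum>u\<in>V. if u \<in> N v then f v / ?c else 0) = f v * real (card (N v)) / ?c" for v
      using pair_finite_verts N_subset[of v] by (simp add: sum.If_cases Int_absorb1)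
    then show ?thesis by (simp add: sum_divide_distrib)
  qed
  finally show ?thesis .
qed

lemma AE_return: "AE \<omega> in M. \<exists>m. \<omega> \<in> space M - out (m + 2)"
proof -
  \<comment> \<open>With weight 1, \<open>visit_term_integral_sums\<close> is the series of these
    probabilities.\<close>
  have "summable (\<lambda>m. prob (out (m + 2)))"
    unfolding prob_out_eq using sums_summable[OF visit_term_integral_sums[of "\<lambda>_. 1"]] by simp
  then have "AE \<omega> in M. eventually (\<lambda>m. \<omega> \<in> space M - out (m + 2)) sequentially"
    by (intro borel_cantelli_AE1) (auto simp: less_top[symmetric])
  then show ?thesis
    by eventually_elim (auto simp: eventually_sequentially)
qed

lemma out_antimono: "m \<le> n \<Longrightarrow> out n \<subseteq> out m"
  by (auto simp: out_def)

text \<open>Expectation and series are exchanged by absolute summability: after the return all terms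
  vanish, and the expected absolute values form the same series with weight \<open>|f|\<close>. As
  the series equals the tour sum only almost surely, measurability of the tour is assumed.\<close>

lemma tour_sum_expectation:
  assumes tour: "(\<lambda>\<omega>. tour I (\<lambda>i. X i \<omega>)) \<in> measurable M (count_space UNIV)"
  shows "has_bochner_integral M (\<lambda>\<omega>. tour_sum f (tour I (\<lambda>i. X i \<omega>)))
    ((\<Sum>v\<in>V - I. f v * real (card (N v))) / real (card (exit_pairs H I)))"
proof -
  have int: "integrable M (visit_term f m)" for f m
    using visit_term_integral by (rule integrable.intros)
  have exp: "integral\<^sup>L M (visit_term f m) = (\<Sum>u\<in>V. \<Sum>v\<in>V - I. f v * traversal_prob m u v)" for f m
    using visit_term_integral by (rule has_bochner_integral_integral_eq)
  have summable: "AE \<omega> in M. summable (\<lambda>m. norm (visit_term f m \<omega>))"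
    using AE_return
  proof eventually_elim
    case (elim \<omega>)
    then obtain n where n: "\<omega> \<notin> out (n + 2)" by auto
    have "\<omega> \<notin> out (m + 2)" if "m \<notin> {..<n}" for m
      using n out_antimono[of "n + 2" "m + 2"] that by auto
    then show ?case
      by (intro summable_finite[of "{..<n}"]) (auto simp: visit_term_def)
  qed
  have summable': "summable (\<lambda>m. \<integral>\<omega>. norm (visit_term f m \<omega>) \<partial>M)"
    unfolding visit_term_norm exp using visit_term_integral_sums by (rule sums_summable)
  have "has_bochner_integral M (\<lambda>\<omega>. \<Sum>m. visit_term f m \<omega>)
    ((\<Sum>v\<in>V - I. f v * real (card (N v))) / real (card (exit_pairs H I)))"
    using integrable_suminf[OF int summable summable'] integral_suminf[OF int summable summable']
      sums_unique[OF visit_term_integral_sums] exp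
    by (simp add: has_bochner_integral_iff)
  moreover have "AE \<omega> in M. tour_sum f (tour I (\<lambda>i. X i \<omega>)) = (\<Sum>m. visit_term f m \<omega>)"
    using AE_return
  proof eventually_elim
    case (elim \<omega>)
    then obtain m where m: "\<omega> \<in> space M" "\<omega> \<notin> out (m + 2)" by auto
    then obtain t where "t \<ge> 2" "X t \<omega> \<in> I" by (auto simp: out_def)
    then show ?case
      using m by (subst tour_sum_eq_suminf[of t]) (auto simp: visit_term_def out_def)
  qed
  moreover have "(\<lambda>\<omega>. tour_sum f (tour I (\<lambda>i. X i \<omega>))) \<in> borel_measurable M"
    using tour by (rule measurable_compose) simp
  ultimately show ?thesis
    using borel_measurable_has_bochner_integral by (subst has_bochner_integral_cong_AE)
qed

end

section \<open>Averaging over the tours\<close>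

text \<open>Linearity of expectation. The number \<open>c\<close> of exit pairs cancels the
  \<open>1 / c\<close> in the mean of each tour sum, and the degrees in \<open>f\<close> cancel
  those in the mean numbers of visits. This leaves the sum over \<open>V - I\<close>; the last term
  of the estimator adds \<open>I\<close>.\<close>

lemma (in supernode) alpha_hat_unbiased:
  fixes X :: "nat \<Rightarrow> nat \<Rightarrow> 'w \<Rightarrow> 'b"
  assumes M: "prob_space M"
    and walk: "\<And>r. r \<in> {1..q} \<Longrightarrow> nrw_from_supernode M H I (X r)"
    and tour: "\<And>r. r \<in> {1..q} \<Longrightarrow>
      (\<lambda>\<omega>. tour I (\<lambda>i. X r i \<omega>)) \<in> measurable M (count_space UNIV)"
    and q: "q \<ge> 1"
  shows "has_bochner_integral M (\<lambda>\<omega>. alpha_hat H R g S I q (\<lambda>r. tour I (\<lambda>i. X r i \<omega>))) (alpha H R g S)"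
proof -
  interpret prob_space M by fact
  define h where "h v = g v * of_bool (R v S)" for v
  define f where "f v = h v / real (card (N v))" for v
  define c where "c = real (card (exit_pairs H I))"
  have hat: "alpha_hat H R g S I q \<tau> = c / real q * (\<Sum>r = 1..q. tour_sum f (\<tau> r)) + sum h I" for \<tau>
    by (simp add: alpha_hat_def tour_sum_def f_def h_def c_def card_exit_pairs)
  have alpha: "alpha H R g S = sum h (V - I) + sum h I"
    unfolding alpha_def h_def[symmetric] by (rule sum.subset_diff[OF I_subset pair_finite_verts])
  have const: "has_bochner_integral M (\<lambda>_. a) a" for a :: real
    by (simp add: has_bochner_integral_iff prob_space)
  show ?thesis
  proof (cases "V = I")
    case True
    \<comment> \<open>No arc leaves \<open>I\<close>, so the factor \<open>c\<close> vanishes and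
      the estimator is the constant sum over \<open>I\<close>, which is all of
      \<open>alpha\<close>.\<close>
    then have "exit_pairs H I = {}"
      using N_subset by (auto simp: exit_pairs_def)
    then have "c = 0"
      by (simp add: c_def)
    then show ?thesis using const by (simp add: hat alpha True)
  next
    case False
    have f: "(\<Sum>v\<in>V - I. f v * real (card (N v))) = sum h (V - I)"
      using N_nonempty finite_N by (intro sum.cong) (auto simp: f_def)
    have one: "has_bochner_integral M (\<lambda>\<omega>. tour_sum f (tour I (\<lambda>i. X r i \<omega>))) (sum h (V - I) / c)"
      if "r \<in> {1..q}" for r
    proof -
      interpret nrw_walk H I M "X r"
        using walk[OF that] False by unfold_locales
      show ?thesis
        using tour_sum_expectation[OF tour[OF that], of f] unfolding f c_def .
    qed
    have "c > 0"
      using exit_pairs_nonempty[OF False] finite_exit_pairs by (simp add: c_def card_gt_0_iff)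
    then have "alpha H R g S = c / real q * (\<Sum>r = 1..q. sum h (V - I) / c) + sum h I"
      using q by (simp add: alpha)
    then show ?thesis
      unfolding hat
      by (auto simp only: intro!: has_bochner_integral_add has_bochner_integral_mult_right
          has_bochner_integral_sum one const)
  qed
qed

theorem theorem1:
  fixes G :: "'a pair_pre_digraph"
    and \<Phi> :: "'a \<Rightarrow> 'l"
    and k q :: nat
    and R :: "'a pair_pre_digraph \<Rightarrow> 'a pair_pre_digraph \<Rightarrow> bool"
    and g :: "'a pair_pre_digraph \<Rightarrow> real"
    and S :: "'a pair_pre_digraph"
    and I :: "'a pair_pre_digraph set"
    and M :: "'w measure"
    and X :: "nat \<Rightarrow> nat \<Rightarrow> 'w \<Rightarrow> 'a pair_pre_digraph"
  assumes "pair_graph G"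
    and "Digraph_Component.connected (with_proj (hon k G))"
    and "\<not> bipartite (hon k G)"
    and "S \<in> conn_induced_subgraphs k G"
    and "I \<subseteq> conn_induced_subgraphs k G" and "I \<noteq> {}"
    and "\<forall>S' \<in> I. R S' S"
    and "q \<ge> 1"
    and "prob_space M"
    and "\<forall>r \<in> {1..q}. nrw_from_supernode M (hon k G) I (X r)"
    and "prob_space.indep_vars M (\<lambda>_. count_space UNIV)
           (\<lambda>r \<omega>. tour I (\<lambda>i. X r i \<omega>)) {1..q}"
  shows "integrable M (\<lambda>\<omega>. alpha_hat (hon k G) R g S I q (\<lambda>r. tour I (\<lambda>i. X r i \<omega>)))
    \<and> prob_space.expectation M
        (\<lambda>\<omega>. alpha_hat (hon k G) R g S I q (\<lambda>r. tour I (\<lambda>i. X r i \<omega>)))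
      = alpha (hon k G) R g S"
proof -
  interpret prob_space M by fact
  interpret hon: pair_graph "hon k G"
    using assms(1) by (rule pair_graph_hon)
  interpret supernode "hon k G" I
    using assms by unfold_locales (auto simp: hon_def)
  have "has_bochner_integral M
      (\<lambda>\<omega>. alpha_hat (hon k G) R g S I q (\<lambda>r. tour I (\<lambda>i. X r i \<omega>))) (alpha (hon k G) R g S)"
    \<comment> \<open>\<open>indep_vars_def2\<close> yields the measurability of each tour.\<close>
    using assms by (intro alpha_hat_unbiased) (auto simp: indep_vars_def2)
  then show ?thesis
    by (simp add: has_bochner_integral_iff)
qed

end
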